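(* Let $(a_n)_{n\ge 0}$ be a sequence of elements of a commutative algebra $R$ over the field $\mathbb{Q}(q)$ of rational functions in the indeterminate $q$, and let $(a_n^* )_{n\ge0}$ be its $q$-dual sequence, $$a_n^*=\sum_{i=0}^n{n \brack i}(-1)^i a_i\, q^{\binom{i}{2}}.$$ Then for all integers $k,l\ge 0$ the following three identities hold: $$\sum_{j=0}^l {l \brack j}\frac{(-1)^j a_{k+j+1}^*}{[k+j+1]_q}\,q^{\binom{j+1}{2}-l(k+j+1)}+\sum_{j=0}^k {k \brack j}\frac{(-1)^j a_{l+j+1}}{[l+j+1]_q}\,q^{\binom{j+1}{2}}=\frac{a_0}{[k+l+1]_q{k+l \brack k}},$$ $$\sum_{j=0}^l{l \brack j}(-1)^j a_{k+j}^*\,q^{\binom{j+1}{2}-l(k+j)}=\sum_{j=0}^k{k \brack j}(-1)^j a_{l+j}\,q^{\binom{j}{2}},$$ $$\sum_{j=0}^{l+1} {l+1 \brack j}(-1)^{j+1}[k+j+1]_q\, a_{k+j}^*\, q^{\binom{j}{2}-l(k+j)-k}=\sum_{j=0}^{k+1} {k+1 \brack j}(-1)^j[l+j+1]_q\, a_{l+j}\,q^{\binom{j-1}{2}}.$$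
   Context: For an integer $k$, $[k]_q=\frac{1-q^k}{1-q}$. For an integer $\alpha$ and integer $k$, the $q$-binomial coefficient is ${\alpha \brack k}=0$ if $k<0$, ${\alpha\brack 0}=1$, and ${\alpha \brack k}=\frac{(1-q^{\alpha})(1-q^{\alpha-1})\cdots(1-q^{\alpha-k+1})}{(1-q)(1-q^2)\cdots(1-q^k)}$ for $k\ge 1$ (so ${n\brack k}=0$ for integers $0\le n<k$). For every integer $m$ (including negative $m$), $\binom{m}{2}=m(m-1)/2$; e.g. $\binom{-1}{2}=1$. *)

theory Defs
  imports
    "HOL-Computational_Algebra.Polynomial"
    "HOL-Computational_Algebra.Fraction_Field"
begin

type_synonym ratfun = "rat poly fract"

definition qvar :: ratfun where
  "qvar = Fract [:0, 1:] 1"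

definition qint :: "int \<Rightarrow> ratfun" where
  "qint k = (1 - qvar powi k) / (1 - qvar)"

definition qbinom :: "int \<Rightarrow> int \<Rightarrow> ratfun" where
  "qbinom \<alpha> k =
     (if k < 0 then 0
      else (\<Prod>i<nat k. 1 - qvar powi (\<alpha> - int i)) / (\<Prod>i=1..nat k. 1 - qvar ^ i))"

text \<open>Commutativity is part of the type class. A unit is not required, so unital algebras
  (including the zero algebra) are covered.\<close>

locale comm_algebra = vector_space scale
  for scale :: "'k::field \<Rightarrow> 'r::comm_ring \<Rightarrow> 'r" +
  assumes scale_mult_left: "scale c (x * y) = scale c x * y"

definition choose2 :: "int \<Rightarrow> int" where
  "choose2 m = m * (m - 1) div 2"

definition qdual :: "(ratfun \<Rightarrow> 'r::comm_ring \<Rightarrow> 'r) \<Rightarrow> (nat \<Rightarrow> 'r) \<Rightarrow> nat \<Rightarrow> 'r" where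
  "qdual scale a n =
     (\<Sum>i=0..n. scale (qbinom (int n) (int i) * (-1) ^ i * qvar powi choose2 (int i)) (a i))"

end

(* Both sides of each identity are finite-difference arrays in (k, l): by the two q-Pascal rules
   they satisfy f(k, l+1) = q^(-k-e) (f(k, l) - f(k+1, l)) with the same shift e in {0, 1}, and
   so does the beta-type right-hand side of the first identity. Hence induction on l, for all k at
   once, reduces everything to l = 0, where the definition of the q-dual sequence and the
   absorption rules for q-binomials suffice. *)
theory Submission
  imports Defs
begin

section \<open>q-binomial coefficients\<close>

lemma qvar_nonzero [simp]: "qvar \<noteq> 0"
  by (simp add: qvar_def Zero_fract_def eq_fract)

lemma qvar_power: "qvar ^ n = Fract (monom 1 n) 1"
proof (induction n)
  case 0
  show ?case by (simp add: One_fract_def)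
next
  case (Suc n)
  then show ?case by (simp add: qvar_def monom_Suc)
qed

text \<open>The indeterminate is not a root of unity, so every denominator
  \<open>1 - qvar ^ n\<close> with positive \<open>n\<close> is nonzero.\<close>

lemma qvar_power_eq_1_iff [simp]: "qvar ^ n = 1 \<longleftrightarrow> n = 0"
  by (simp add: qvar_power One_fract_def eq_fract monom_eq_1_iff)

lemma qvar_neq_1 [simp]: "qvar \<noteq> 1" "1 \<noteq> qvar"
  using qvar_power_eq_1_iff[of 1] by (auto simp del: qvar_power_eq_1_iff)

text \<open>Same fact in the shape that the simplifier gives to \<open>qvar ^ Suc n\<close>.\<close>

lemma qvar_mult_power_neq_1 [simp]: "qvar * qvar ^ n \<noteq> 1" "1 \<noteq> qvar * qvar ^ n"
  using qvar_power_eq_1_iff[of "Suc n"] by (auto simp del: qvar_power_eq_1_iff)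

lemma qvar_powi_add: "qvar powi (m + n) = qvar powi m * qvar powi n"
  by (rule power_int_add) simp

lemma choose2_Suc: "choose2 (m + 1) = choose2 m + m"
proof -
  have "(m + 1) * (m + 1 - 1) = m * (m - 1) + m * 2"
    by (simp add: algebra_simps)
  then show ?thesis
    by (simp add: choose2_def)
qed

lemma choose2_pred: "choose2 (m - 1) = choose2 m - m + 1"
  using choose2_Suc[of "m - 1"] by simp

lemma choose2_0 [simp]: "choose2 0 = 0"
  by (simp add: choose2_def)

lemma choose2_1 [simp]: "choose2 1 = 0"
  by (simp add: choose2_def)

section \<open>Absorption and Pascal rules\<close>

lemma qbinom_0 [simp]: "qbinom \<alpha> 0 = 1"
  by (simp add: qbinom_def)

lemma qbinom_Suc_right:
  "qbinom \<alpha> (int (Suc k)) = (1 - qvar powi (\<alpha> - int k)) * qbinom \<alpha> (int k) / (1 - qvar ^ Suc k)"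
proof -
  have n: "nat (1 + int k) = Suc k" by simp
  show ?thesis
    by (simp add: qbinom_def n prod.nat_ivl_Suc' mult.commute)
qed

text \<open>Here the first factor of the numerator is split off, while
  \<open>qbinom_Suc_right\<close> splits off the last one.\<close>

lemma qbinom_absorb:
  "qbinom (\<alpha> + 1) (int (Suc k)) = (1 - qvar powi (\<alpha> + 1)) * qbinom \<alpha> (int k) / (1 - qvar ^ Suc k)"
proof -
  have n: "nat (1 + int k) = Suc k" by simp
  have "(\<Prod>i<Suc k. 1 - qvar powi (\<alpha> + 1 - int i))
      = (1 - qvar powi (\<alpha> + 1)) * (\<Prod>i<k. 1 - qvar powi (\<alpha> - int i))"
    by (subst prod.lessThan_Suc_shift) simp
  then show ?thesis
    by (simp add: qbinom_def n prod.nat_ivl_Suc' mult.commute del: prod.lessThan_Suc)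
qed

text \<open>For \<open>k = Suc i\<close> the two ways of splitting off a numerator factor meet in
  \<open>qbinom \<alpha> (int i)\<close>. The rule is kept free of division because the left factor
  vanishes at \<open>\<alpha> + 1 = int k\<close>.\<close>

lemma qbinom_Suc_upper:
  "(1 - qvar powi (\<alpha> + 1 - int k)) * qbinom (\<alpha> + 1) (int k) = (1 - qvar powi (\<alpha> + 1)) * qbinom \<alpha> (int k)"
proof (cases k)
  case (Suc i)
  have "\<alpha> + 1 - int k = \<alpha> - int i"
    using Suc by simp
  then show ?thesis
    unfolding Suc by (simp only: qbinom_Suc_right[of \<alpha>] qbinom_absorb times_divide_eq_right mult.left_commute)
qed simp

lemma qvar_powi_split: "qvar powi (\<alpha> + 1) = qvar powi (\<alpha> - int k) * qvar ^ Suc k"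
  using qvar_powi_add[of "\<alpha> - int k" "int (Suc k)"]
  by (simp only: power_int_of_nat) simp

text \<open>All three terms are multiples of \<open>X = qbinom \<alpha> (int k)\<close>; what
  remains is \<open>(1 - P) + P * (1 - Q) = 1 - P * Q\<close>.\<close>

lemma qbinom_pascal:
  "qbinom (\<alpha> + 1) (int (Suc k)) = qbinom \<alpha> (int (Suc k)) + qvar powi (\<alpha> - int k) * qbinom \<alpha> (int k)"
proof -
  have "(1 - P) * X / (1 - Q) + P * X = (1 - P * Q) * X / (1 - Q)" if "1 - Q \<noteq> 0" for P Q X :: ratfun
    using that by (simp add: field_simps)
  from this[of "qvar ^ Suc k"] show ?thesis
    unfolding qbinom_Suc_right[of \<alpha>] qbinom_absorb qvar_powi_split[of \<alpha> k] by simp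
qed

text \<open>The other way to split \<open>1 - P * Q\<close>, namely
  \<open>Q * (1 - P) + (1 - Q)\<close>.\<close>

lemma qbinom_pascal':
  "qbinom (\<alpha> + 1) (int (Suc k)) = qvar ^ Suc k * qbinom \<alpha> (int (Suc k)) + qbinom \<alpha> (int k)"
proof -
  have "Q * ((1 - P) * X / (1 - Q)) + X = (1 - P * Q) * X / (1 - Q)" if "1 - Q \<noteq> 0" for P Q X :: ratfun
    using that by (simp add: field_simps)
  from this[of "qvar ^ Suc k"] show ?thesis
    unfolding qbinom_Suc_right[of \<alpha>] qbinom_absorb qvar_powi_split[of \<alpha> k] by simp
qed

lemma qbinom_eq_0: "n < k \<Longrightarrow> qbinom (int n) (int k) = 0"
  by (force simp: qbinom_def)

text \<open>A q-analogue of the Beta value B(k+1, l+1) = k! l! / (k+l+1)!.\<close>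

definition qbeta :: "nat \<Rightarrow> nat \<Rightarrow> ratfun" where
  "qbeta k l = 1 / (qint (int (k + l + 1)) * qbinom (int (k + l)) (int k))"

lemma qbeta_0_right: "qbeta k 0 = 1 / qint (int (k + 1))"
proof -
  have "qbinom (int k) (int k) = 1"
  proof (induction k)
    case (Suc k)
    then show ?case
      using qbinom_pascal'[of "int k" k] qbinom_eq_0[of k "Suc k"]
      by (simp add: add.commute)
  qed simp
  then show ?thesis
    by (simp add: qbeta_def)
qed

text \<open>With all three values expressed through \<open>X\<close>, the claim becomes
  \<open>(1 - A) + A * (1 - B) = 1 - A * B\<close>.\<close>

lemma qbeta_rec: "qbeta k l = qbeta (Suc k) l + qvar ^ Suc k * qbeta k (Suc l)"
proof -
  define X where "X = qbinom (int (k + l)) (int k)"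
  define A where "A = qvar ^ Suc k"
  define B where "B = qvar ^ Suc l"
  define M where "M = qvar ^ (k + l + 1)"
  have AB: "qvar ^ (k + l + 2) = A * B"
    by (simp add: A_def B_def power_add)
  have nz: "1 - A \<noteq> 0" "1 - B \<noteq> 0" "1 - M \<noteq> 0" "1 - A * B \<noteq> 0"
    unfolding AB[symmetric] unfolding A_def B_def M_def
    by (simp_all only: right_minus_eq eq_commute[of 1] qvar_power_eq_1_iff)
  have Y: "qbinom (int (Suc k + l)) (int (Suc k)) = (1 - M) * X / (1 - A)"
    using qbinom_absorb[of "int (k + l)" k] power_int_of_nat[of qvar "k + l + 1"]
    by (simp add: X_def A_def M_def add.commute)
  have "qbinom (int (k + Suc l)) (int k) * (1 - B) = (1 - M) * X"
    using qbinom_Suc_upper[of "int (k + l)" k] power_int_of_nat[of qvar "k + l + 1"] power_int_of_nat[of qvar "Suc l"]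
    by (simp add: X_def B_def M_def add.commute mult.commute)
  then have Z: "qbinom (int (k + Suc l)) (int k) = (1 - M) * X / (1 - B)"
    using nz by (simp add: eq_divide_eq)
  have q: "qint (int (k + l + 1)) = (1 - M) / (1 - qvar)"
     "qint (int (Suc k + l + 1)) = (1 - A * B) / (1 - qvar)"
     "qint (int (k + Suc l + 1)) = (1 - A * B) / (1 - qvar)"
    unfolding AB[symmetric] M_def qint_def power_int_of_nat by simp_all
  show ?thesis
  \<comment> \<open>If \<open>X\<close> vanished, division by 0 would make all three values 0; hence
    \<open>X\<close> may be taken nonzero.\<close>
  proof (cases "X = 0")
    case True
    then show ?thesis unfolding qbeta_def Y Z X_def[symmetric] by simp
  next
    case False
    then show ?thesis
      unfolding qbeta_def q Y Z X_def[symmetric] A_def[symmetric]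
      using nz by (simp add: divide_simps) (simp add: algebra_simps)
  qed
qed

section \<open>Difference arrays\<close>

locale ratfun_space = vector_space scale
  for scale :: "ratfun \<Rightarrow> 'r::ab_group_add \<Rightarrow> 'r"
begin

text \<open>The shifts \<open>e\<close> = 1, 0, -1 give the right-hand sums of the first, second and
  third identity, the last up to a factor \<open>qvar\<close>; \<open>e = 0\<close> and
  \<open>l = 0\<close> give the q-dual sequence.\<close>

definition alt_sum :: "int \<Rightarrow> nat \<Rightarrow> (nat \<Rightarrow> 'r) \<Rightarrow> nat \<Rightarrow> 'r" where
  "alt_sum e n b l =
     (\<Sum>j=0..n. scale (qbinom (int n) (int j) * (-1) ^ j * qvar powi (choose2 (int j) + e * int j))
        (b (l + j)))"

text \<open>Common form of the sums over the dual sequence: \<open>k\<close> becomes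
  \<open>k + 1\<close> in the first identity, and \<open>n = l + 1\<close> in the third, up to
  sign.\<close>

definition neg_sum :: "nat \<Rightarrow> (nat \<Rightarrow> 'r) \<Rightarrow> nat \<Rightarrow> 'r" where
  "neg_sum n b k =
     (\<Sum>j=0..n. scale (qbinom (int n) (int j) * (-1) ^ j
          * qvar powi (choose2 (int (j + 1)) - int n * int (k + j)))
        (b (k + j)))"

text \<open>The sum of length \<open>n\<close> is padded by a vanishing term so that Pascal's rule
  applies termwise. This version puts the power of q on the shifted part, as \<open>alt_sum\<close>
  requires; the primed one puts it on the unshifted part, for \<open>neg_sum\<close>.\<close>

lemma qbinom_sum_Suc:
  "(\<Sum>j=0..Suc n. scale (qbinom (int (Suc n)) (int j)) (F j))
   = (\<Sum>j=0..n. scale (qbinom (int n) (int j)) (F j))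
     + (\<Sum>j=0..n. scale (qbinom (int n) (int j) * qvar powi (int n - int j)) (F (Suc j)))"
proof -
  have "(\<Sum>j=0..n. scale (qbinom (int n) (int j)) (F j))
      = (\<Sum>j=0..Suc n. scale (qbinom (int n) (int j)) (F j))"
    using qbinom_eq_0[of n "Suc n"] by simp
  also have "\<dots> = F 0 + (\<Sum>j=0..n. scale (qbinom (int n) (int (Suc j))) (F (Suc j)))"
    by (subst sum.atLeast0_atMost_Suc_shift) simp
  finally show ?thesis
    using qbinom_pascal[of "int n"]
    by (subst sum.atLeast0_atMost_Suc_shift)
      (simp add: scale_left_distrib sum.distrib ac_simps)
qed

lemma qbinom_sum_Suc':
  "(\<Sum>j=0..Suc n. scale (qbinom (int (Suc n)) (int j)) (F j))
   = (\<Sum>j=0..n. scale (qbinom (int n) (int j) * qvar ^ j) (F j))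
     + (\<Sum>j=0..n. scale (qbinom (int n) (int j)) (F (Suc j)))"
proof -
  have "(\<Sum>j=0..n. scale (qbinom (int n) (int j) * qvar ^ j) (F j))
      = (\<Sum>j=0..Suc n. scale (qbinom (int n) (int j) * qvar ^ j) (F j))"
    using qbinom_eq_0[of n "Suc n"] by simp
  also have "\<dots> = F 0 + (\<Sum>j=0..n. scale (qbinom (int n) (int (Suc j)) * qvar ^ Suc j) (F (Suc j)))"
    by (subst sum.atLeast0_atMost_Suc_shift) simp
  finally show ?thesis
    using qbinom_pascal'[of "int n"]
    by (subst sum.atLeast0_atMost_Suc_shift)
      (simp add: scale_left_distrib sum.distrib ac_simps)
qed

text \<open>In the shifted half, the power from Pascal's rule cancels the growth \<open>j\<close> of
  the triangular exponent, so \<open>n + e\<close> no longer depends on \<open>j\<close> and leaves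
  the sum.\<close>

lemma alt_sum_Suc:
  "alt_sum e (Suc n) b l = alt_sum e n b l - scale (qvar powi (int n + e)) (alt_sum e n b (Suc l))"
proof -
  define F where "F j = scale ((-1) ^ j * qvar powi (choose2 (int j) + e * int j)) (b (l + j))" for j
  have c: "qvar powi (int n - int j) * qvar powi (choose2 (int (Suc j)) + e * int (Suc j))
      = qvar powi (int n + e) * qvar powi (choose2 (int j) + e * int j)" for j
    using choose2_Suc[of "int j"]
    by (simp add: qvar_powi_add[symmetric] algebra_simps)
  have "scale (qbinom (int n) (int j) * qvar powi (int n - int j)) (F (Suc j))
     = - scale (qvar powi (int n + e)) (scale (qbinom (int n) (int j) * (-1) ^ j
          * qvar powi (choose2 (int j) + e * int j)) (b (Suc l + j)))" for j
    using c[of j] by (simp add: F_def scale_minus_left[symmetric] del: scale_minus_left)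
  moreover have "alt_sum e n b l = (\<Sum>j=0..n. scale (qbinom (int n) (int j)) (F j))" for n
    by (simp add: alt_sum_def F_def mult.assoc)
  ultimately show ?thesis
    using qbinom_sum_Suc[of n F]
    by (simp add: alt_sum_def[of e n b "Suc l"] scale_sum_right sum_negf)
qed

text \<open>Raising \<open>n\<close> in the exponent costs \<open>k + j\<close> or
  \<open>k + 1 + j\<close>. The \<open>j\<close> or \<open>j + 1\<close> is repaid by Pascal's rule
  (\<open>c1\<close>) or by the triangular exponent (\<open>c2\<close>), leaving \<open>- k\<close>
  in both halves.\<close>

lemma neg_sum_Suc:
  "neg_sum (Suc n) b k = scale (qvar powi (- int k)) (neg_sum n b k - neg_sum n b (Suc k))"
proof -
  define F where "F j = scale ((-1) ^ j
    * qvar powi (choose2 (int (j + 1)) - int (Suc n) * int (k + j))) (b (k + j))" for j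
  have c1: "qvar ^ j * qvar powi (choose2 (int (j + 1)) - int (Suc n) * int (k + j))
      = qvar powi (- int k) * qvar powi (choose2 (int (j + 1)) - int n * int (k + j))" for j
    unfolding power_int_of_nat[of qvar j, symmetric] qvar_powi_add[symmetric]
    by (simp add: algebra_simps)
  have c2: "qvar powi (choose2 (int (Suc j + 1)) - int (Suc n) * int (Suc k + j))
      = qvar powi (- int k) * qvar powi (choose2 (int (j + 1)) - int n * int (Suc k + j))" for j
    using choose2_Suc[of "int (j + 1)"]
    by (simp add: qvar_powi_add[symmetric] algebra_simps)
  have "scale (qbinom (int n) (int j) * qvar ^ j) (F j)
     = scale (qvar powi (- int k)) (scale (qbinom (int n) (int j) * (-1) ^ j
          * qvar powi (choose2 (int (j + 1)) - int n * int (k + j))) (b (k + j)))" for j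
    unfolding F_def scale_scale
    using arg_cong[OF c1[of j], where f = "\<lambda>c. scale (qbinom (int n) (int j) * (-1) ^ j * c) (b (k + j))"]
    by (simp only: mult_ac)
  moreover have "scale (qbinom (int n) (int j)) (F (Suc j))
     = - scale (qvar powi (- int k)) (scale (qbinom (int n) (int j) * (-1) ^ j
          * qvar powi (choose2 (int (j + 1)) - int n * int (Suc k + j))) (b (Suc k + j)))" for j
    unfolding F_def scale_scale scale_minus_left[symmetric] add_Suc_shift[symmetric] power_Suc
    using arg_cong[OF c2[of j], where f = "\<lambda>c. scale (- (qbinom (int n) (int j) * (-1) ^ j * c)) (b (Suc k + j))"]
    by (simp only: mult_minus_left mult_minus_right mult_1 mult_ac)
  moreover have "neg_sum (Suc n) b k = (\<Sum>j=0..Suc n. scale (qbinom (int (Suc n)) (int j)) (F j))"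
    by (simp only: neg_sum_def F_def scale_scale mult.assoc)
  ultimately show ?thesis
    using qbinom_sum_Suc'[of n F]
    by (simp add: neg_sum_def[of n] scale_sum_right sum_negf scale_right_diff_distrib)
qed

lemma neg_sum_0 [simp]: "neg_sum 0 b k = b k"
  by (simp add: neg_sum_def)

text \<open>Solved for the shifted start, the recurrence takes the form of
  \<open>neg_sum_Suc\<close> with length and start exchanged.\<close>

lemma alt_sum_Suc_start:
  "alt_sum e n b (Suc l) = scale (qvar powi (- (int n + e))) (alt_sum e n b l - alt_sum e (Suc n) b l)"
proof -
  have "qvar powi (- (int n + e)) * qvar powi (int n + e) = 1"
    using qvar_powi_add[of "- (int n + e)" "int n + e"] by simp
  then show ?thesis
    by (simp add: alt_sum_Suc)
qed

section \<open>The dual sequence\<close>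

abbreviation dual :: "(nat \<Rightarrow> 'r) \<Rightarrow> nat \<Rightarrow> 'r" where
  "dual a n \<equiv> alt_sum 0 n a 0"

text \<open>The second identity: both sides are \<open>dual a k\<close> at \<open>l = 0\<close>, and
  both recurrences carry the factor \<open>qvar powi (- int k)\<close>.\<close>

lemma neg_sum_dual: "neg_sum l (dual a) k = alt_sum 0 k a l"
  by (induction l arbitrary: k) (simp_all add: neg_sum_Suc alt_sum_Suc_start)

text \<open>Case \<open>l = 0\<close> of the first identity. Absorption turns
  \<open>qbinom k j / [j+1]\<close> into \<open>qbinom (k+1) (j+1) / [k+1]\<close>, so the sum is,
  up to sign and scaling, the dual at \<open>k + 1\<close> without its term
  \<open>a 0\<close>.\<close>

lemma alt_sum_div_qint_0:
  "alt_sum 1 k (\<lambda>i. scale (1 / qint (int i)) (a i)) 1 = scale (1 / qint (int (k + 1))) (a 0 - dual a (k + 1))"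
proof -
  have c: "qbinom (int k) (int j) * (1 / qint (int (Suc j)))
      = 1 / qint (int (Suc k)) * qbinom (int (Suc k)) (int (Suc j))" for j :: nat
    using qbinom_absorb[of "int k" j]
      power_int_of_nat[of qvar "Suc k"] power_int_of_nat[of qvar "Suc j"]
    by (simp add: qint_def add.commute)
  have p: "choose2 (int (Suc j)) + 0 * int (Suc j) = choose2 (int j) + 1 * int j" for j
    using choose2_Suc[of "int j"] by (simp add: add.commute)
  let ?G = "\<lambda>j. scale (qbinom (int (Suc k)) (int j) * (-1) ^ j * qvar powi (choose2 (int j) + 0 * int j)) (a (0 + j))"
  have "scale (qbinom (int k) (int j) * (-1) ^ j * qvar powi (choose2 (int j) + 1 * int j))
        (scale (1 / qint (int (1 + j))) (a (1 + j)))
     = - scale (1 / qint (int (Suc k))) (?G (Suc j))" for j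
    unfolding p scale_scale scale_minus_left[symmetric] plus_nat.add_0 plus_1_eq_Suc power_Suc
    using arg_cong[OF c[of j], where f = "\<lambda>c. scale (c * ((-1) ^ j * qvar powi (choose2 (int j) + 1 * int j))) (a (Suc j))"]
    by (simp only: mult_minus_left mult_minus_right mult_1 minus_minus mult_ac)
  then have "alt_sum 1 k (\<lambda>i. scale (1 / qint (int i)) (a i)) 1
      = scale (1 / qint (int (Suc k))) (- (\<Sum>j=0..k. ?G (Suc j)))"
    by (simp only: alt_sum_def scale_sum_right sum_negf scale_minus_right)
  moreover have "dual a (Suc k) = a 0 + (\<Sum>j=0..k. ?G (Suc j))"
    unfolding alt_sum_def by (subst sum.atLeast0_atMost_Suc_shift) simp
  ultimately show ?thesis
    by simp
qed

text \<open>The first identity. The start \<open>Suc k\<close> of \<open>neg_sum\<close>, the shift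
  \<open>e = 1\<close> of \<open>alt_sum\<close> and \<open>qbeta_rec\<close> all yield the factor
  \<open>qvar powi (- int (Suc k))\<close>.\<close>

lemma neg_sum_dual_div_qint:
  "neg_sum l (\<lambda>i. scale (1 / qint (int i)) (dual a i)) (Suc k)
   + alt_sum 1 k (\<lambda>i. scale (1 / qint (int i)) (a i)) (Suc l) = scale (qbeta k l) (a 0)"
proof (induction l arbitrary: k)
  case 0
  then show ?case
    using alt_sum_div_qint_0[of k a] by (simp add: qbeta_0_right scale_right_diff_distrib)
next
  case (Suc l)
  have i: "int k + 1 = int (Suc k)" by simp
  have "qbeta k (Suc l) = qvar powi (- int (Suc k)) * (qbeta k l - qbeta (Suc k) l)"
    using qbeta_rec[of k l]
    by (simp add: power_int_minus power_int_of_nat field_simps del: of_nat_Suc power_Suc)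
  then have "scale (qbeta k (Suc l)) (a 0) = scale (qvar powi (- int (Suc k)))
      (scale (qbeta k l) (a 0) - scale (qbeta (Suc k) l) (a 0))"
    by (simp only: scale_scale[symmetric] scale_left_diff_distrib)
  then show ?case
    unfolding neg_sum_Suc[of l] alt_sum_Suc_start[of 1 k _ "Suc l"] i
    unfolding Suc[symmetric] scale_right_distrib[symmetric] by simp
qed

text \<open>Core of the case \<open>l = 0\<close> of the third identity, compared coefficientwise:
  \<open>[k+1] * qbinom k j = [k+1-j] * qbinom (k+1) j\<close>, and \<open>[k+2] - [k+1-j]\<close>
  is a power of q times \<open>[j+1]\<close>.\<close>

lemma alt_sum_mult_qint_0:
  "scale (qvar powi (int k + 1)) (alt_sum (-1) (Suc k) (\<lambda>i. scale (qint (int (i + 1))) (a i)) 0)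
   = scale (qint (int (k + 2))) (dual a (Suc k)) - scale (qint (int (k + 1))) (dual a k)"
proof -
  have "qint (int (k + 1)) * qbinom (int k) (int j)
      = qint (int (k + 1) - int j) * qbinom (int (Suc k)) (int j)" for j
    using qbinom_Suc_upper[of "int k" j] by (simp add: qint_def ac_simps)
  moreover have "qint (int (k + 2)) - qint (int (k + 1) - int j)
      = qvar powi (int k + 1 - int j) * qint (int (j + 1))" for j
    using qvar_powi_add[of "int k + 1 - int j" "int (j + 1)"]
    by (simp add: qint_def diff_divide_distrib[symmetric] algebra_simps)
  ultimately have c: "qint (int (k + 2)) * qbinom (int (Suc k)) (int j) - qint (int (k + 1)) * qbinom (int k) (int j)
      = qvar powi (int k + 1 - int j) * qint (int (j + 1)) * qbinom (int (Suc k)) (int j)" for j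
    by (metis left_diff_distrib)
  have d: "qvar powi (int k + 1) * qvar powi (choose2 (int j) + (-1) * int j)
      = qvar powi (int k + 1 - int j) * qvar powi choose2 (int j)" for j
    by (simp add: qvar_powi_add[symmetric] algebra_simps)
  have m: "Q * (B * S * R * I) = J * (B * S * T) - K * (C * S * T)"
    if "J * B - K * C = U * I * B" "Q * R = U * T" for Q B S R I J K C T U :: ratfun
    using that by algebra
  have e: "scale (qvar powi (int k + 1)) (scale (qbinom (int (Suc k)) (int j) * (-1) ^ j
        * qvar powi (choose2 (int j) + (-1) * int j)) (scale (qint (int (j + 1))) (a j)))
      = scale (qint (int (k + 2))) (scale (qbinom (int (Suc k)) (int j) * (-1) ^ j * qvar powi choose2 (int j)) (a j))
      - scale (qint (int (k + 1))) (scale (qbinom (int k) (int j) * (-1) ^ j * qvar powi choose2 (int j)) (a j))" for j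
    unfolding scale_scale scale_left_diff_distrib[symmetric]
    by (rule arg_cong[where f = "\<lambda>c. scale c (a j)"]) (rule m[OF c d])
  \<comment> \<open>A zero term at \<open>j = Suc k\<close> gives all three sums the same
    range.\<close>
  have "dual a k = (\<Sum>j=0..Suc k. scale (qbinom (int k) (int j) * (-1) ^ j * qvar powi choose2 (int j)) (a j))"
    using qbinom_eq_0[of k "Suc k"] by (simp add: alt_sum_def)
  then show ?thesis
    by (simp only: alt_sum_def[of _ "Suc k"] scale_sum_right sum_subtractf[symmetric] e
        mult_zero_left add_0_right add_0_left)
qed

text \<open>The third identity. Length \<open>Suc k\<close> and shift \<open>e = -1\<close> combine
  to the factor \<open>qvar powi (- int k)\<close>, which matches
  \<open>neg_sum_Suc\<close>.\<close>

lemma neg_sum_dual_mult_qint: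
  "- neg_sum (Suc l) (\<lambda>i. scale (qint (int (i + 1))) (dual a i)) k
   = scale qvar (alt_sum (-1) (Suc k) (\<lambda>i. scale (qint (int (i + 1))) (a i)) l)"
proof (induction l arbitrary: k)
  case 0
  have "qvar powi (- int k) * qvar powi (int k + 1) = qvar"
    using qvar_powi_add[of "- int k" "int k + 1"] by simp
  then have "scale qvar (alt_sum (-1) (Suc k) (\<lambda>i. scale (qint (int (i + 1))) (a i)) 0)
      = scale (qvar powi (- int k)) (scale (qint (int (k + 2))) (dual a (Suc k))
          - scale (qint (int (k + 1))) (dual a k))"
    unfolding alt_sum_mult_qint_0[symmetric] scale_scale by simp
  then show ?case
    unfolding neg_sum_Suc[of 0] by (simp add: scale_right_diff_distrib)
next
  case (Suc l)
  let ?T = "alt_sum (-1) (Suc k) (\<lambda>i. scale (qint (int (i + 1))) (a i)) l"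
  let ?T' = "alt_sum (-1) (Suc (Suc k)) (\<lambda>i. scale (qint (int (i + 1))) (a i)) l"
  have "- neg_sum (Suc (Suc l)) (\<lambda>i. scale (qint (int (i + 1))) (dual a i)) k
      = scale (qvar powi (- int k)) (scale qvar ?T - scale qvar ?T')"
    unfolding neg_sum_Suc[of "Suc l"] Suc[symmetric] by (simp add: scale_right_diff_distrib)
  also have "\<dots> = scale qvar (scale (qvar powi (- int k)) (?T - ?T'))"
    by (simp add: scale_right_diff_distrib mult.commute)
  finally show ?case
    by (simp add: alt_sum_Suc_start)
qed

end

theorem theorem1:
  fixes scale :: "ratfun \<Rightarrow> 'r::comm_ring \<Rightarrow> 'r"
    and a :: "nat \<Rightarrow> 'r"
    and k l :: nat
  assumes "comm_algebra scale"
  shows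
    "((\<Sum>j=0..l. scale (qbinom (int l) (int j) * ((-1) ^ j / qint (int (k + j + 1)))
          * qvar powi (choose2 (int (j + 1)) - int l * int (k + j + 1)))
        (qdual scale a (k + j + 1)))
     + (\<Sum>j=0..k. scale (qbinom (int k) (int j) * ((-1) ^ j / qint (int (l + j + 1)))
          * qvar powi choose2 (int (j + 1)))
        (a (l + j + 1)))
     = scale (1 / (qint (int (k + l + 1)) * qbinom (int (k + l)) (int k))) (a 0))
     \<and>
     ((\<Sum>j=0..l. scale (qbinom (int l) (int j) * (-1) ^ j
          * qvar powi (choose2 (int (j + 1)) - int l * int (k + j)))
        (qdual scale a (k + j)))
     = (\<Sum>j=0..k. scale (qbinom (int k) (int j) * (-1) ^ j * qvar powi choose2 (int j))
        (a (l + j))))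
     \<and>
     ((\<Sum>j=0..l+1. scale (qbinom (int (l + 1)) (int j) * (-1) ^ (j + 1) * qint (int (k + j + 1))
          * qvar powi (choose2 (int j) - int l * int (k + j) - int k))
        (qdual scale a (k + j)))
     = (\<Sum>j=0..k+1. scale (qbinom (int (k + 1)) (int j) * (-1) ^ j * qint (int (l + j + 1))
          * qvar powi choose2 (int j - 1))
        (a (l + j))))"
proof -
  interpret comm_algebra scale by fact
  interpret ratfun_space scale ..
  have dual: "qdual scale a = dual a"
    by (simp add: qdual_def alt_sum_def fun_eq_iff)
  have 1: "(\<Sum>j=0..l. scale (qbinom (int l) (int j) * ((-1) ^ j / qint (int (k + j + 1)))
          * qvar powi (choose2 (int (j + 1)) - int l * int (k + j + 1))) (dual a (k + j + 1)))
      = neg_sum l (\<lambda>i. scale (1 / qint (int i)) (dual a i)) (Suc k)"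
    by (simp add: neg_sum_def)
  have 2: "(\<Sum>j=0..k. scale (qbinom (int k) (int j) * ((-1) ^ j / qint (int (l + j + 1)))
          * qvar powi choose2 (int (j + 1))) (a (l + j + 1)))
      = alt_sum 1 k (\<lambda>i. scale (1 / qint (int i)) (a i)) (Suc l)"
    using choose2_Suc[of "int _"] by (simp add: alt_sum_def add.commute)
  have 3: "(\<Sum>j=0..l+1. scale (qbinom (int (l + 1)) (int j) * (-1) ^ (j + 1) * qint (int (k + j + 1))
          * qvar powi (choose2 (int j) - int l * int (k + j) - int k)) (dual a (k + j)))
      = - neg_sum (Suc l) (\<lambda>i. scale (qint (int (i + 1))) (dual a i)) k"
  proof -
    \<comment> \<open>The length \<open>l + 1\<close> takes a further \<open>k + j\<close> off the
      exponent; its \<open>j\<close> lowers the triangular number and its \<open>k\<close> is the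
      extra summand.\<close>
    have "choose2 (int (j + 1)) - int (Suc l) * int (k + j) = choose2 (int j) - int l * int (k + j) - int k" for j
      using choose2_Suc[of "int j"] by (simp add: algebra_simps)
    then show ?thesis
      unfolding neg_sum_def by (simp add: sum_negf[symmetric] mult_ac del: sum.atLeast0_atMost_Suc)
  qed
  have 4: "(\<Sum>j=0..k+1. scale (qbinom (int (k + 1)) (int j) * (-1) ^ j * qint (int (l + j + 1))
          * qvar powi choose2 (int j - 1)) (a (l + j)))
      = scale qvar (alt_sum (-1) (Suc k) (\<lambda>i. scale (qint (int (i + 1))) (a i)) l)"
  proof -
    \<comment> \<open>The extra factor \<open>qvar\<close> is the value at \<open>j = 0\<close>,
      where the triangular number of -1 is 1.\<close>
    have "qvar powi choose2 (int j - 1) = qvar * qvar powi (choose2 (int j) + (-1) * int j)" for j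
      using qvar_powi_add[of 1 "choose2 (int j) - int j"] by (simp add: choose2_pred algebra_simps)
    then show ?thesis
      unfolding alt_sum_def by (simp add: scale_sum_right scale_right_diff_distrib mult_ac)
  qed
  show ?thesis
    unfolding dual 1 2 3 4
    using neg_sum_dual_div_qint[of l a k] neg_sum_dual[of l a k] neg_sum_dual_mult_qint[of l a k]
    by (simp add: qbeta_def neg_sum_def alt_sum_def[of 0 k a l])
qed

end
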